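(* In the feature-learning framework with expanding dataset described in the context, and under its standing assumptions, the following hold. There exists a nonempty set $\mathcal{G}\subsetneq\mathcal{S}$ such that one always (i.e. regardless of how ties are broken) obtains $\mathcal{L}_{\mathrm{warm}}^{(1)}=\mathcal{L}_{\mathrm{cold}}^{(1)}=\mathcal{G}$. For all integers $J\ge 2$ (and regardless of how ties are broken), $$\mathrm{ACC}\left(\mathcal{L}_{\mathrm{warm}}^{(J)}\right)\le \mathrm{ACC}\left(\mathcal{L}_{\mathrm{cold}}^{(J)}\right),\qquad T_{\mathrm{warm}}^{(J)}<T_{\mathrm{cold}}^{(J)}.$$ Furthermore, $\delta:=\max_{v\in\mathcal{S}\setminus\mathcal{G}}h(v;\mathcal{G})>0$, and $\mathrm{ACC}(\mathcal{L}_{\mathrm{warm}}^{(J)})<\mathrm{ACC}(\mathcal{L}_{\mathrm{cold}}^{(J)})$ holds whenever $J>\frac{\gamma}{\delta n}$.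
   Context: **Features and data.** Let $C\ge 2$ be the number of classes, $[C]=\{1,\dots,C\}$. For each class $c\in[C]$ there is a set of $K$ features $\mathcal{S}_c=\{v_{c,1},\dots,v_{c,K}\}$; the sets $\mathcal{S}_c$ are pairwise disjoint, and $\mathcal{S}=\bigcup_{c\in[C]}\mathcal{S}_c$. A data point is a pair $(x,y)$ with label $y\in[C]$ and an associated feature set $\mathcal{V}(x)\subset\mathcal{S}_y$. Distinct data points may have the same label and feature set (they differ by point-specific noise). Parameters: an integer $\tau\ge 1$ with $\tau<K$, and a real $\gamma>0$ (noise strength). Here $\subset$ allows equality. **Frequency.** For a finite dataset $\mathcal{T}$ and $\mathcal{N}\subset\mathcal{T}$, $g(v;\mathcal{T},\mathcal{N})=\frac{1}{|\mathcal{T}|}\sum_{(x,y)\in\mathcal{N}}\mathbb{1}(v\in\mathcal{V}(x))$. **Training process.** Input: a learned feature set $\mathcal{L}\subset\mathcal{S}$, a set $\mathcal{M}$ of memorized data points, and a dataset $\mathcal{T}$. Initialize the set of data points with non-zero gradient $\mathcal{N}=\{(x,y)\in\mathcal{T}: |\mathcal{V}(x)\cap\mathcal{L}|<\tau,\ (x,y)\notin\mathcal{M}\}$. While $\mathcal{N}\ne\emptyset$: choose $v\in\arg\max_{u\in\mathcal{S}\setminus\mathcal{L}}g(u;\mathcal{T},\mathcal{N})$, ties broken arbitrarily. If $g(v;\mathcal{T},\mathcal{N})\ge\gamma/|\mathcal{T}|$, then $v$ is learned: replace $\mathcal{L}$ by $\mathcal{L}\cup\{v\}$ and then $\mathcal{N}$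 by $\{(x,y)\in\mathcal{N}:|\mathcal{V}(x)\cap\mathcal{L}|<\tau\}$. Otherwise (no feature in $\mathcal{S}\setminus\mathcal{L}$ reaches the threshold) replace $\mathcal{M}$ by $\mathcal{M}\cup\mathcal{N}$, set $\mathcal{N}=\emptyset$ and stop. Output: the final $\mathcal{L}$ and $\mathcal{M}$. **Expanding dataset (standing assumption).** There are pairwise disjoint chunks $\mathcal{T}_1,\mathcal{T}_2,\dots$ of $n$ data points each. For each class $c$ and each $\mathcal{A}\subset\mathcal{S}_c$, every chunk $\mathcal{T}_j$ contains exactly $n_{\mathcal{A}}\ge 1$ data points of class $c$ with feature set $\mathcal{A}$, where $n_{\mathcal{A}}$ does not depend on $j$; thus $\sum_{c\in[C],\mathcal{A}\subset\mathcal{S}_c}n_{\mathcal{A}}=n$. The $j$-th experiment runs the training process on $\mathcal{T}_{1:j}=\bigcup_{l\in[j]}\mathcal{T}_l$. **Function $h$.** $h(v;\mathcal{L})=\frac1n\sum_{c\in[C],\mathcal{A}\subset\mathcal{S}_c}n_{\mathcal{A}}\cdot\mathbb{1}(v\in\mathcal{A}\wedge|\mathcal{A}\cap\mathcal{L}|<\tau)$. **Standing assumption.** (i) For any $\mathcal{L}\subset\mathcal{S}$, if $v_1,v_2\in\mathcal{S}_c$ for some class $c$ and $h(v_1;\mathcal{L})=h(v_2;\mathcal{L})$, then $v_1=v_2$. (ii) For any class $c\in[C]$ there exist $\tau$ distinct features $v_1,\dots,v_\tau\in\mathcal{S}_c$ such that $g(v_i;\mathcal{T}_j,\mathcal{T}_j)\ge\gamma/n$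 for $i=1,\dots,\tau-1$ and $g(v_\tau;\mathcal{T}_j,\mathcal{T}_j)<\gamma/n$ (these quantities do not depend on $j$). **Initialization methods.** For a method, let $\mathcal{L}^{(j)},\mathcal{M}^{(j)}$ be the output of the $j$-th experiment, and let $\mathcal{N}^{(j,0)}$ be the initial set $\mathcal{N}$ of the training process in the $j$-th experiment. - Cold-starting: every experiment $j$ is started from $\mathcal{L}=\emptyset$, $\mathcal{M}=\emptyset$. - Warm-starting: experiment $j$ is started from $\mathcal{L}=\mathcal{L}_{\mathrm{warm}}^{(j-1)}$, $\mathcal{M}=\mathcal{M}_{\mathrm{warm}}^{(j-1)}$, with $\mathcal{L}_{\mathrm{warm}}^{(0)}=\mathcal{M}_{\mathrm{warm}}^{(0)}=\emptyset$. **Test accuracy and training time.** For $\mathcal{L}\subset\mathcal{S}$, $\mathrm{ACC}(\mathcal{L})=1-\frac{C-1}{C}\cdot\frac1n\sum_{c\in[C],\mathcal{A}\subset\mathcal{S}_c}n_{\mathcal{A}}\cdot\mathbb{1}(|\mathcal{A}\cap\mathcal{L}|<\tau)$. Further, $T_{\mathrm{warm}}^{(J)}=\sum_{j\in[J]}|\mathcal{N}_{\mathrm{warm}}^{(j,0)}|$ and $T_{\mathrm{cold}}^{(J)}=\sum_{j\in[J]}|\mathcal{N}_{\mathrm{cold}}^{(j,0)}|$. *)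

theory Defs
  imports Complex_Main "HOL-Library.Disjoint_Sets"
begin

text \<open>
  A data point is a pair \<open>(x, y)\<close> of an input \<open>x\<close> and a label \<open>y\<close>, and \<open>V x\<close> is its feature set.
  Classes are the numbers in \<open>{1..C}\<close>, and \<open>F c\<close> is the set of features of class \<open>c\<close>.
  Chunks and experiments are indexed from 1; the value at index 0 of a chunk sequence is ignored.
\<close>

definition all_features :: "nat \<Rightarrow> (nat \<Rightarrow> 'f set) \<Rightarrow> 'f set" where
  "all_features C F = (\<Union>c\<in>{1..C}. F c)"

definition freq :: "('x \<Rightarrow> 'f set) \<Rightarrow> 'f \<Rightarrow> ('x \<times> nat) set \<Rightarrow> ('x \<times> nat) set \<Rightarrow> real" where
  "freq V v T N = (1 / real (card T)) * (\<Sum>(x, y)\<in>N. of_bool (v \<in> V x))"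

definition unfit :: "('x \<Rightarrow> 'f set) \<Rightarrow> nat \<Rightarrow> 'f set \<Rightarrow> ('x \<times> nat) set \<Rightarrow> ('x \<times> nat) set" where
  "unfit V \<tau> L N = {(x, y) \<in> N. card (V x \<inter> L) < \<tau>}"

definition init_active ::
    "('x \<Rightarrow> 'f set) \<Rightarrow> nat \<Rightarrow> ('x \<times> nat) set \<Rightarrow> 'f set \<Rightarrow> ('x \<times> nat) set \<Rightarrow> ('x \<times> nat) set" where
  "init_active V \<tau> T L M = {(x, y) \<in> T. card (V x \<inter> L) < \<tau> \<and> (x, y) \<notin> M}"

text \<open>
  \<open>train_loop S V \<tau> \<gamma> T L M N L' M'\<close>: some execution of the while loop on the dataset \<open>T\<close>, started
  in the state \<open>(L, M, N)\<close>, ends with output \<open>(L', M')\<close>. It is a relation because ties in the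
  arg max are broken arbitrarily. The last rule also covers \<open>L = S\<close> with \<open>N \<noteq> {}\<close>, where the
  arg max ranges over the empty set: no unlearned feature reaches the threshold, so the loop
  memorizes \<open>N\<close> and stops.
\<close>

inductive train_loop ::
    "'f set \<Rightarrow> ('x \<Rightarrow> 'f set) \<Rightarrow> nat \<Rightarrow> real \<Rightarrow> ('x \<times> nat) set \<Rightarrow>
     'f set \<Rightarrow> ('x \<times> nat) set \<Rightarrow> ('x \<times> nat) set \<Rightarrow> 'f set \<Rightarrow> ('x \<times> nat) set \<Rightarrow> bool"
  for S :: "'f set" and V :: "'x \<Rightarrow> 'f set" and \<tau> :: nat and \<gamma> :: real and T :: "('x \<times> nat) set"
where
  finished: "train_loop S V \<tau> \<gamma> T L M {} L M"
| learn: "N \<noteq> {} \<Longrightarrow> is_arg_max (\<lambda>u. freq V u T N) (\<lambda>u. u \<in> S - L) v \<Longrightarrow>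
    freq V v T N \<ge> \<gamma> / real (card T) \<Longrightarrow>
    train_loop S V \<tau> \<gamma> T (L \<union> {v}) M (unfit V \<tau> (L \<union> {v}) N) L' M' \<Longrightarrow>
    train_loop S V \<tau> \<gamma> T L M N L' M'"
| memorize: "N \<noteq> {} \<Longrightarrow> (\<And>u. u \<in> S - L \<Longrightarrow> freq V u T N < \<gamma> / real (card T)) \<Longrightarrow>
    train_loop S V \<tau> \<gamma> T L M N L (M \<union> N)"

definition trains ::
    "'f set \<Rightarrow> ('x \<Rightarrow> 'f set) \<Rightarrow> nat \<Rightarrow> real \<Rightarrow> ('x \<times> nat) set \<Rightarrow>
     'f set \<Rightarrow> ('x \<times> nat) set \<Rightarrow> 'f set \<Rightarrow> ('x \<times> nat) set \<Rightarrow> bool" where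
  "trains S V \<tau> \<gamma> T L M L' M' \<longleftrightarrow> train_loop S V \<tau> \<gamma> T L M (init_active V \<tau> T L M) L' M'"

definition data_upto :: "(nat \<Rightarrow> 'd set) \<Rightarrow> nat \<Rightarrow> 'd set" where
  "data_upto Tc j = (\<Union>l\<in>{1..j}. Tc l)"

definition hfun ::
    "nat \<Rightarrow> (nat \<Rightarrow> 'f set) \<Rightarrow> nat \<Rightarrow> nat \<Rightarrow> ('f set \<Rightarrow> nat) \<Rightarrow> 'f \<Rightarrow> 'f set \<Rightarrow> real" where
  "hfun C F \<tau> n nA v L =
     (1 / real n) *
     (\<Sum>c\<in>{1..C}. \<Sum>A\<in>Pow (F c). real (nA A) * of_bool (v \<in> A \<and> card (A \<inter> L) < \<tau>))"

definition acc ::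
    "nat \<Rightarrow> (nat \<Rightarrow> 'f set) \<Rightarrow> nat \<Rightarrow> nat \<Rightarrow> ('f set \<Rightarrow> nat) \<Rightarrow> 'f set \<Rightarrow> real" where
  "acc C F \<tau> n nA L =
     1 - (real C - 1) / real C * (1 / real n) *
     (\<Sum>c\<in>{1..C}. \<Sum>A\<in>Pow (F c). real (nA A) * of_bool (card (A \<inter> L) < \<tau>))"

text \<open>
  A run is one possible sequence of outputs \<open>(L j, M j)\<close> of the experiments \<open>j = 1, 2, \<dots>\<close>, for some
  way of breaking ties. The index 0 of a cold-started run carries no meaning.
\<close>

definition cold_run ::
    "'f set \<Rightarrow> ('x \<Rightarrow> 'f set) \<Rightarrow> nat \<Rightarrow> real \<Rightarrow> (nat \<Rightarrow> ('x \<times> nat) set) \<Rightarrow>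
     (nat \<Rightarrow> 'f set) \<Rightarrow> (nat \<Rightarrow> ('x \<times> nat) set) \<Rightarrow> bool" where
  "cold_run S V \<tau> \<gamma> Tc L M \<longleftrightarrow>
     (\<forall>j\<ge>1. trains S V \<tau> \<gamma> (data_upto Tc j) {} {} (L j) (M j))"

definition warm_run ::
    "'f set \<Rightarrow> ('x \<Rightarrow> 'f set) \<Rightarrow> nat \<Rightarrow> real \<Rightarrow> (nat \<Rightarrow> ('x \<times> nat) set) \<Rightarrow>
     (nat \<Rightarrow> 'f set) \<Rightarrow> (nat \<Rightarrow> ('x \<times> nat) set) \<Rightarrow> bool" where
  "warm_run S V \<tau> \<gamma> Tc L M \<longleftrightarrow>
     L 0 = {} \<and> M 0 = {} \<and>
     (\<forall>j\<ge>1. trains S V \<tau> \<gamma> (data_upto Tc j) (L (j - 1)) (M (j - 1)) (L j) (M j))"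

definition time_cold :: "('x \<Rightarrow> 'f set) \<Rightarrow> nat \<Rightarrow> (nat \<Rightarrow> ('x \<times> nat) set) \<Rightarrow> nat \<Rightarrow> nat" where
  "time_cold V \<tau> Tc J = (\<Sum>j\<in>{1..J}. card (init_active V \<tau> (data_upto Tc j) {} {}))"

definition time_warm ::
    "('x \<Rightarrow> 'f set) \<Rightarrow> nat \<Rightarrow> (nat \<Rightarrow> ('x \<times> nat) set) \<Rightarrow>
     (nat \<Rightarrow> 'f set) \<Rightarrow> (nat \<Rightarrow> ('x \<times> nat) set) \<Rightarrow> nat \<Rightarrow> nat" where
  "time_warm V \<tau> Tc L M J =
     (\<Sum>j\<in>{1..J}. card (init_active V \<tau> (data_upto Tc j) (L (j - 1)) (M (j - 1))))"

text \<open>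
  Each learning step adds an element of the finite set \<open>S\<close> to \<open>L\<close>, so there are no infinite
  executions and nothing is lost by the big-step relation. The loop never gets stuck either: runs
  of both kinds exist, so quantifying over all runs is not vacuous.
\<close>

lemma train_loop_exists:
  assumes "finite S"
  shows "\<exists>L' M'. train_loop S V \<tau> \<gamma> T L M N L' M'"
proof (induction "card (S - L)" arbitrary: L N rule: less_induct)
  case less
  consider "N = {}" | "N \<noteq> {}" "\<forall>u\<in>S - L. freq V u T N < \<gamma> / real (card T)"
    | u where "N \<noteq> {}" "u \<in> S - L" "freq V u T N \<ge> \<gamma> / real (card T)"
    by force
  then show ?case
  proof cases
    case 1
    then show ?thesis by (auto intro: train_loop.finished)
  next
    case 2
    then show ?thesis by (blast intro: train_loop.memorize)
  next
    case 3
    let ?I = "(\<lambda>u. freq V u T N) ` (S - L)"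
    have fin: "finite ?I" using assms by simp
    then have "Max ?I \<in> ?I" using 3 by (intro Max_in) auto
    then obtain v where v: "v \<in> S - L" "freq V v T N = Max ?I" by auto
    have ge: "freq V w T N \<le> freq V v T N" if "w \<in> S - L" for w
      unfolding v(2) using that by (intro Max_ge[OF fin]) auto
    then have "is_arg_max (\<lambda>u. freq V u T N) (\<lambda>u. u \<in> S - L) v"
      using v by (auto simp: is_arg_max_def not_less)
    moreover have "freq V v T N \<ge> \<gamma> / real (card T)"
      using ge[OF 3(2)] 3(3) by linarith
    moreover have "card (S - (L \<union> {v})) < card (S - L)"
      using v assms by (intro psubset_card_mono) auto
    ultimately show ?thesis
      using less[of "L \<union> {v}" "unfit V \<tau> (L \<union> {v}) N"] 3(1)
      by (blast intro: train_loop.learn)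
  qed
qed

lemma cold_run_exists:
  assumes "finite S"
  shows "\<exists>L M. cold_run S V \<tau> \<gamma> Tc L M"
proof -
  have "\<forall>j. \<exists>p. trains S V \<tau> \<gamma> (data_upto Tc j) {} {} (fst p) (snd p)"
    using train_loop_exists[OF assms] unfolding trains_def by fastforce
  then obtain p where "\<And>j. trains S V \<tau> \<gamma> (data_upto Tc j) {} {} (fst (p j)) (snd (p j))"
    by metis
  then have "cold_run S V \<tau> \<gamma> Tc (fst \<circ> p) (snd \<circ> p)"
    by (simp add: cold_run_def)
  then show ?thesis by blast
qed

lemma warm_run_exists:
  assumes "finite S"
  shows "\<exists>L M. warm_run S V \<tau> \<gamma> Tc L M"
proof -
  have "\<exists>p. \<forall>j. (j = 0 \<longrightarrow> p j = ({}, {})) \<and>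
    trains S V \<tau> \<gamma> (data_upto Tc (Suc j)) (fst (p j)) (snd (p j)) (fst (p (Suc j))) (snd (p (Suc j)))"
    using dependent_nat_choice
      [where P = "\<lambda>j p. j = 0 \<longrightarrow> p = ({}, {})" and Q = "\<lambda>j p q.
        trains S V \<tau> \<gamma> (data_upto Tc (Suc j)) (fst p) (snd p) (fst q) (snd q)"]
      train_loop_exists[OF assms] unfolding trains_def by fastforce
  then obtain p where p: "p 0 = ({}, {})"
    "\<And>j. trains S V \<tau> \<gamma> (data_upto Tc (Suc j)) (fst (p j)) (snd (p j)) (fst (p (Suc j))) (snd (p (Suc j)))"
    by blast
  have "warm_run S V \<tau> \<gamma> Tc (fst \<circ> p) (snd \<circ> p)"
    unfolding warm_run_def
  proof (intro conjI allI impI)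
    fix j :: nat assume "1 \<le> j"
    then show "trains S V \<tau> \<gamma> (data_upto Tc j) ((fst \<circ> p) (j - 1)) ((snd \<circ> p) (j - 1))
      ((fst \<circ> p) j) ((snd \<circ> p) j)"
      using p(2)[of "j - 1"] by simp
  qed (simp_all add: p(1))
  then show ?thesis by blast
qed

end

theory Submission
  imports Defs
begin

text \<open>
  On a union of \<open>i\<close> chunks, the number of unfit data points containing \<open>v\<close> is \<open>i * n * h(v; L)\<close>, and
  \<open>h(v; L)\<close> depends only on the part of \<open>L\<close> in the class of \<open>v\<close>. The training process is therefore,
  inside each class, a greedy process with a strictly unique maximizer; so its result is determined
  by the threshold \<open>\<gamma> / (i * n)\<close> and grows as the threshold decreases. A warm-started experiment
  sees only the new chunk as active data, so its threshold stays \<open>\<gamma> / n\<close> and nothing beyond \<open>G\<close> is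
  learned, while the cold threshold \<open>\<gamma> / (J * n)\<close> eventually falls below \<open>\<delta>\<close>. As \<open>G\<close> already contains
  \<open>\<tau> - 1\<close> features of every class, one more feature fits new data points.
\<close>

section \<open>Greedy sets\<close>

text \<open>Describes every intermediate state of greedy selection in \<open>B\<close>, not only its
  end results. That nothing above the threshold is left is imposed separately where it is
  needed.\<close>

inductive greedy :: "'f set \<Rightarrow> ('f \<Rightarrow> 'f set \<Rightarrow> real) \<Rightarrow> real \<Rightarrow> 'f set \<Rightarrow> bool"
  for B :: "'f set" and h :: "'f \<Rightarrow> 'f set \<Rightarrow> real" and \<theta> :: real
where
  empty: "greedy B h \<theta> {}"
| insert: "greedy B h \<theta> L \<Longrightarrow> v \<in> B - L \<Longrightarrow> (\<And>u. u \<in> B - L \<Longrightarrow> h u L \<le> h v L) \<Longrightarrow> \<theta> \<le> h v L \<Longrightarrow>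
    greedy B h \<theta> (insert v L)"

lemma greedy_subset: "greedy B h \<theta> L \<Longrightarrow> L \<subseteq> B"
  by (induction rule: greedy.induct) auto

context
  fixes B :: "'f set" and h :: "'f \<Rightarrow> 'f set \<Rightarrow> real"
  assumes inj: "\<And>L u v. L \<subseteq> B \<Longrightarrow> u \<in> B \<Longrightarrow> v \<in> B \<Longrightarrow> h u L = h v L \<Longrightarrow> u = v"
begin

text \<open>The selection leading to \<open>L'\<close> grows by one element at a time through sets
  comparable with \<open>L\<close>, so it hits \<open>L\<close> exactly before exceeding it. The
  element added there maximizes \<open>h\<close> on \<open>B - L\<close>, hence is \<open>v\<close>
  by injectivity. Comparability is a premise because it is the induction hypothesis of the next
  lemma.\<close>

lemma greedy_argmax_mem:
  assumes "greedy B h \<theta>' L'" "L \<subset> L'"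
    and comparable: "\<And>L'. greedy B h \<theta>' L' \<Longrightarrow> L \<subseteq> L' \<or> L' \<subseteq> L"
    and v: "v \<in> B - L" "\<And>u. u \<in> B - L \<Longrightarrow> h u L \<le> h v L"
  shows "v \<in> L'"
  using assms(1,2)
proof (induction rule: greedy.induct)
  case (insert L'' w)
  consider "L \<subset> L''" | "L = L''" | "L'' \<subset> L"
    using comparable[OF insert.hyps(1)] by auto
  then show ?case
  proof cases
    case 2
    have "h w L = h v L"
      using insert.hyps(2,3) v 2 by (intro antisym) auto
    moreover have "L \<subseteq> B"
      using greedy_subset[OF insert.hyps(1)] 2 by simp
    ultimately have "w = v"
      using insert.hyps(2) v(1) by (intro inj) auto
    then show ?thesis by simp
  qed (use insert in auto)
qed simp

text \<open>Thresholds decide only when selection stops, not in which order elements come, so greedy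
  sets for different thresholds form one chain.\<close>

lemma greedy_comparable:
  assumes "greedy B h \<theta> L" "greedy B h \<theta>' L'"
  shows "L \<subseteq> L' \<or> L' \<subseteq> L"
  using assms
proof (induction arbitrary: L' rule: greedy.induct)
  case (insert L v)
  then show ?case
    using greedy_argmax_mem[OF insert.prems, of L v] by (cases "L \<subset> L'") blast+
qed simp

lemma greedy_subset_maximal:
  assumes "greedy B h \<theta> L" "greedy B h \<theta>' L'" "\<theta>' \<le> \<theta>"
    and maximal: "\<And>u. u \<in> B - L' \<Longrightarrow> h u L' < \<theta>'"
  shows "L \<subseteq> L'"
  using assms(1)
proof (induction rule: greedy.induct)
  case (insert L v)
  \<comment> \<open>Otherwise \<open>v\<close> would be left out of \<open>L'\<close> with value at
    least \<open>\<theta>\<close>, hence at least \<open>\<theta>'\<close>.\<close>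
  have "L \<noteq> L'"
    using maximal[of v] insert.hyps(2,4) assms(3) by auto
  then show ?case
    using greedy_argmax_mem[OF assms(2), of L v] greedy_comparable[OF insert.hyps(1)] insert by blast
qed simp

end

section \<open>The training process on expanding datasets\<close>

text \<open>Points fitted by \<open>L\<close> stay fitted by larger sets, so the step-by-step
  filtering of the loop agrees with filtering the original data once. Finiteness guards against
  \<open>card\<close> being 0 on infinite sets.\<close>

lemma unfit_unfit:
  assumes "L \<subseteq> L'" "\<And>x y. (x, y) \<in> X \<Longrightarrow> finite (V x)"
  shows "unfit V \<tau> L' (unfit V \<tau> L X) = unfit V \<tau> L' X"
proof -
  have "card (V x \<inter> L) \<le> card (V x \<inter> L')" if "(x, y) \<in> X" for x y
    using assms that by (intro card_mono) auto
  then show ?thesis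
    unfolding unfit_def by (force dest: le_less_trans)
qed

locale expanding_dataset =
  fixes C K \<tau> n :: nat and \<gamma> :: real
    and F :: "nat \<Rightarrow> 'f set"
    and V :: "'x \<Rightarrow> 'f set"
    and Tc :: "nat \<Rightarrow> ('x \<times> nat) set"
    and nA :: "'f set \<Rightarrow> nat"
  assumes C: "C \<ge> 2"
    and card_F: "\<And>c. c \<in> {1..C} \<Longrightarrow> finite (F c) \<and> card (F c) = K"
    and disjoint_F: "disjoint_family_on F {1..C}"
    and \<tau>: "1 \<le> \<tau>" "\<tau> < K"
    and \<gamma>: "\<gamma> > 0"
    and disjoint_chunks: "disjoint_family_on Tc {1..}"
    and card_chunk: "\<And>j. j \<ge> 1 \<Longrightarrow> finite (Tc j) \<and> card (Tc j) = n"
    and data_points: "\<And>j x y. j \<ge> 1 \<Longrightarrow> (x, y) \<in> Tc j \<Longrightarrow> y \<in> {1..C} \<and> V x \<subseteq> F y"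
    and nA_pos: "\<And>c A. c \<in> {1..C} \<Longrightarrow> A \<subseteq> F c \<Longrightarrow> nA A \<ge> 1"
    and nA_count: "\<And>j c A. j \<ge> 1 \<Longrightarrow> c \<in> {1..C} \<Longrightarrow> A \<subseteq> F c \<Longrightarrow>
          card {(x, y) \<in> Tc j. y = c \<and> V x = A} = nA A"
    and h_inj: "\<And>L c v1 v2. L \<subseteq> all_features C F \<Longrightarrow> c \<in> {1..C} \<Longrightarrow> v1 \<in> F c \<Longrightarrow> v2 \<in> F c \<Longrightarrow>
          hfun C F \<tau> n nA v1 L = hfun C F \<tau> n nA v2 L \<Longrightarrow> v1 = v2"
    and learnable: "\<And>c. c \<in> {1..C} \<Longrightarrow>
          \<exists>v :: nat \<Rightarrow> 'f. inj_on v {1..\<tau>} \<and> v ` {1..\<tau>} \<subseteq> F c \<and>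
            (\<forall>j\<ge>1. (\<forall>i\<in>{1..\<tau> - 1}. freq V (v i) (Tc j) (Tc j) \<ge> \<gamma> / real n) \<and>
                   freq V (v \<tau>) (Tc j) (Tc j) < \<gamma> / real n)"
begin

abbreviation S :: "'f set" where "S \<equiv> all_features C F"

abbreviation h :: "'f \<Rightarrow> 'f set \<Rightarrow> real" where "h \<equiv> hfun C F \<tau> n nA"

abbreviation accuracy :: "'f set \<Rightarrow> real" where "accuracy \<equiv> acc C F \<tau> n nA"

abbreviation chunks :: "nat set \<Rightarrow> ('x \<times> nat) set" where "chunks I \<equiv> (\<Union>l\<in>I. Tc l)"

section \<open>Features, classes and counting of data points\<close>

lemma F_subset_S: "c \<in> {1..C} \<Longrightarrow> F c \<subseteq> S"
  by (auto simp: all_features_def)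

lemma mem_S: "v \<in> S \<longleftrightarrow> (\<exists>c\<in>{1..C}. v \<in> F c)"
  by (auto simp: all_features_def)

lemma finite_F: "c \<in> {1..C} \<Longrightarrow> finite (F c)"
  using card_F by blast

lemma finite_S: "finite S"
  unfolding all_features_def using finite_F by blast

lemma card_Int_mono: "c \<in> {1..C} \<Longrightarrow> A \<subseteq> F c \<Longrightarrow> L \<subseteq> L' \<Longrightarrow> card (A \<inter> L) \<le> card (A \<inter> L')"
  by (meson Int_mono card_mono finite_F finite_Int order_refl rev_finite_subset)

lemma F_unique: "c \<in> {1..C} \<Longrightarrow> d \<in> {1..C} \<Longrightarrow> v \<in> F c \<Longrightarrow> v \<in> F d \<Longrightarrow> c = d"
  using disjoint_F unfolding disjoint_family_on_def by blast

lemma finite_V: "j \<ge> 1 \<Longrightarrow> (x, y) \<in> Tc j \<Longrightarrow> finite (V x)"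
  by (meson data_points finite_F finite_subset)

text \<open>Groups the points of a chunk by class and feature set; the group of
  \<open>(c, A)\<close> has \<open>nA A\<close> points.\<close>

lemma sum_chunk:
  fixes f :: "'f set \<Rightarrow> real"
  assumes "j \<ge> 1"
  shows "(\<Sum>(x, y)\<in>Tc j. f (V x)) = (\<Sum>c\<in>{1..C}. \<Sum>A\<in>Pow (F c). real (nA A) * f A)"
proof -
  let ?g = "\<lambda>(x, y). (y, V x)" and ?I = "SIGMA c:{1..C}. Pow (F c)"
  have "(\<Sum>(x, y)\<in>Tc j. f (V x)) = (\<Sum>p\<in>?I. \<Sum>(x, y)\<in>{z \<in> Tc j. ?g z = p}. f (V x))"
    using card_chunk[OF assms] data_points[OF assms] finite_F
    by (intro sum.group[symmetric]) auto
  also have "\<dots> = (\<Sum>(c, A)\<in>?I. real (nA A) * f A)"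
  proof (intro sum.cong refl)
    fix p assume "p \<in> ?I"
    then obtain c A where p: "p = (c, A)" "c \<in> {1..C}" "A \<subseteq> F c" by auto
    have "(\<Sum>(x, y)\<in>{z \<in> Tc j. ?g z = p}. f (V x)) = (\<Sum>z\<in>{(x, y) \<in> Tc j. y = c \<and> V x = A}. f A)"
      using p by (intro sum.cong) auto
    also have "\<dots> = real (nA A) * f A"
      using nA_count[OF assms p(2,3)] by simp
    finally show "(\<Sum>(x, y)\<in>{z \<in> Tc j. ?g z = p}. f (V x)) = (case p of (c, A) \<Rightarrow> real (nA A) * f A)"
      using p by simp
  qed
  also have "\<dots> = (\<Sum>c\<in>{1..C}. \<Sum>A\<in>Pow (F c). real (nA A) * f A)"
    using finite_F by (intro sum.Sigma[symmetric]) auto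
  finally show ?thesis .
qed

text \<open>Points without features can never be fitted. They keep the active set nonempty, so that
  every execution ends by memorizing.\<close>

lemma exists_empty_point:
  assumes "j \<ge> 1"
  obtains x y where "(x, y) \<in> Tc j" "V x = {}"
proof -
  have "1 \<in> {1..C}" using C by simp
  then have "card {(x, y) \<in> Tc j. y = 1 \<and> V x = {}} \<ge> 1"
    using nA_count[OF assms, of 1 "{}"] nA_pos[of 1 "{}"] by simp
  then have "{(x, y) \<in> Tc j. y = 1 \<and> V x = {}} \<noteq> {}"
    by (metis card.empty not_one_le_zero)
  then show ?thesis using that by blast
qed

lemma n_pos: "n > 0"
  using exists_empty_point[of 1] card_chunk[of 1] by (metis card_gt_0_iff empty_iff order_refl)

section \<open>Locality and size of \<open>h\<close>\<close>

lemma h_class: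
  assumes "c \<in> {1..C}" "v \<in> F c"
  shows "h v L = (1 / real n) * (\<Sum>A\<in>Pow (F c). real (nA A) * of_bool (v \<in> A \<and> card (A \<inter> L) < \<tau>))"
proof -
  have "(\<Sum>A\<in>Pow (F d). real (nA A) * of_bool (v \<in> A \<and> card (A \<inter> L) < \<tau>)) = 0"
    if "d \<in> {1..C} - {c}" for d
    using F_unique[of c d v] assms that by (intro sum.neutral) auto
  then show ?thesis
    unfolding hfun_def using assms(1) by (subst sum.remove[of _ c]) auto
qed

text \<open>Lets the training process be analyzed inside each class separately.\<close>

lemma h_local:
  assumes "c \<in> {1..C}" "v \<in> F c"
  shows "h v (L \<inter> F c) = h v L"
proof -
  have "A \<inter> (L \<inter> F c) = A \<inter> L" if "A \<in> Pow (F c)" for A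
    using that by blast
  then show ?thesis
    unfolding h_class[OF assms] by (intro arg_cong2[where f = "(*)"] refl sum.cong) auto
qed

lemma h_le_empty: "h v L \<le> h v {}"
  unfolding hfun_def using \<tau> by (intro mult_left_mono sum_mono) auto

text \<open>With fewer than \<open>\<tau>\<close> learned features in the class, none of its points
  is fitted yet.\<close>

lemma h_eq_empty:
  assumes "c \<in> {1..C}" "v \<in> F c" "card (L \<inter> F c) < \<tau>"
  shows "h v L = h v {}"
proof -
  have "card (A \<inter> L) < \<tau>" if "A \<in> Pow (F c)" for A
  proof -
    have "card (A \<inter> L) \<le> card (L \<inter> F c)"
      using that finite_F[OF assms(1)] by (intro card_mono) auto
    then show ?thesis using assms(3) by simp
  qed
  then show ?thesis
    unfolding h_class[OF assms(1,2)]
    using \<tau> by (intro arg_cong2[where f = "(*)"] refl sum.cong) auto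
qed

text \<open>For \<open>\<tau> = 1\<close> all values \<open>h(v; S)\<close> vanish, which contradicts the injectivity assumption.\<close>

lemma \<tau>_ge_2: "\<tau> \<ge> 2"
proof (rule ccontr)
  assume "\<not> \<tau> \<ge> 2"
  then have t: "\<tau> = 1" using \<tau> by simp
  have c: "1 \<in> {1..C}" using C by simp
  have zero: "h v S = 0" if "v \<in> F 1" for v
  proof -
    have "\<not> card (A \<inter> S) < \<tau>" if "v \<in> A" "A \<subseteq> F 1" for A
    proof -
      have "v \<in> A \<inter> S" using that F_subset_S[OF c] by auto
      moreover have "finite (A \<inter> S)" using finite_S by simp
      ultimately show ?thesis using t card_gt_0_iff[of "A \<inter> S"] by auto
    qed
    then show ?thesis
      unfolding h_class[OF c that] by (auto intro!: sum.neutral)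
  qed
  have "card (F 1) > 1" using card_F[OF c] \<tau> by simp
  then obtain u v where "u \<in> F 1" "v \<in> F 1" "u \<noteq> v"
    by (metis One_nat_def card_le_Suc0_iff_eq card_F c linorder_not_less)
  then show False using h_inj[of S 1 u v] zero c by simp
qed

text \<open>The points with feature set \<open>{v}\<close> always count, since one feature cannot
  fit them when \<open>\<tau> \<ge> 2\<close>. This is the source of
  \<open>\<delta> > 0\<close>.\<close>

lemma h_pos:
  assumes "v \<in> S"
  shows "h v L > 0"
proof -
  obtain c where c: "c \<in> {1..C}" "v \<in> F c" using assms mem_S by blast
  have "card ({v} \<inter> L) \<le> 1"
    by (metis card.empty card.insert card_mono finite.intros Int_lower1 empty_iff One_nat_def)
  then have "card ({v} \<inter> L) < \<tau>" using \<tau>_ge_2 by simp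
  moreover have "nA {v} \<ge> 1" using nA_pos c by simp
  ultimately have "0 < (\<Sum>A\<in>Pow (F c). real (nA A) * of_bool (v \<in> A \<and> card (A \<inter> L) < \<tau>))"
    using c finite_F by (intro sum_pos2[of _ "{v}"]) auto
  then show ?thesis
    unfolding h_class[OF c] using n_pos by simp
qed

text \<open>Each chunk contributes the same amount, so frequencies are proportional to
  \<open>h\<close> with a factor that does not depend on the feature.\<close>

lemma sum_unfit_chunks:
  assumes I: "finite I" "I \<subseteq> {1..}"
  shows "(\<Sum>(x, y)\<in>unfit V \<tau> L (chunks I). of_bool (v \<in> V x)) = real (card I) * (real n * h v L)"
proof -
  have fin: "finite (chunks I)" using I card_chunk by blast
  have disj: "\<forall>i\<in>I. \<forall>j\<in>I. i \<noteq> j \<longrightarrow> Tc i \<inter> Tc j = {}"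
    using I(2) disjoint_chunks unfolding disjoint_family_on_def by blast
  have "(\<Sum>(x, y)\<in>unfit V \<tau> L (chunks I). of_bool (v \<in> V x)) =
      (\<Sum>(x, y)\<in>chunks I. of_bool (v \<in> V x \<and> card (V x \<inter> L) < \<tau>) :: real)"
    by (intro sum.mono_neutral_cong_left fin) (auto simp: unfit_def)
  also have "\<dots> = (\<Sum>l\<in>I. \<Sum>(x, y)\<in>Tc l. of_bool (v \<in> V x \<and> card (V x \<inter> L) < \<tau>))"
    using I card_chunk disj by (intro sum.UNION_disjoint) auto
  also have "\<dots> = (\<Sum>l\<in>I. real n * h v L)"
  proof (intro sum.cong refl)
    fix l assume "l \<in> I"
    then have "l \<ge> 1" using I by auto
    from sum_chunk[OF this, of "\<lambda>A. of_bool (v \<in> A \<and> card (A \<inter> L) < \<tau>)"]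
    show "(\<Sum>(x, y)\<in>Tc l. of_bool (v \<in> V x \<and> card (V x \<inter> L) < \<tau>)) = real n * h v L"
      unfolding hfun_def using n_pos by simp
  qed
  finally show ?thesis by simp
qed

text \<open>Translates the learnability assumption into statements about
  \<open>h v {}\<close>.\<close>

lemma freq_chunk:
  assumes "j \<ge> 1"
  shows "freq V v (Tc j) (Tc j) = h v {}"
proof -
  have "unfit V \<tau> {} (chunks {j}) = Tc j" using \<tau> by (auto simp: unfit_def)
  then show ?thesis
    using sum_unfit_chunks[where I = "{j}" and L = "{}"] assms n_pos card_chunk by (simp add: freq_def)
qed

section \<open>End states of training\<close>

text \<open>Greediness is required class by class because \<open>h\<close> is injective only within
  a class; features of different classes may tie.\<close>

definition stable :: "real \<Rightarrow> 'f set \<Rightarrow> bool" where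
  "stable \<theta> L \<longleftrightarrow> L \<subseteq> S \<and> (\<forall>c\<in>{1..C}. greedy (F c) h \<theta> (L \<inter> F c)) \<and> (\<forall>u\<in>S - L. h u L < \<theta>)"

lemma stable_less: "stable \<theta> L \<Longrightarrow> u \<in> S \<Longrightarrow> u \<notin> L \<Longrightarrow> h u L < \<theta>"
  unfolding stable_def by blast

lemma stable_mono:
  assumes "stable \<theta> L" "stable \<theta>' L'" "\<theta>' \<le> \<theta>"
  shows "L \<subseteq> L'"
proof -
  have "L \<inter> F c \<subseteq> L' \<inter> F c" if c: "c \<in> {1..C}" for c
  proof (rule greedy_subset_maximal[where B = "F c" and h = h])
    show "u = v" if "M \<subseteq> F c" "u \<in> F c" "v \<in> F c" "h u M = h v M" for M u v
      using h_inj[of M c u v] that c F_subset_S by blast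
    show "h u (L' \<inter> F c) < \<theta>'" if "u \<in> F c - L' \<inter> F c" for u
      using assms(2) that h_local[OF c, of u L'] F_subset_S[OF c] by (auto simp: stable_def)
  qed (use assms c in \<open>auto simp: stable_def\<close>)
  then show ?thesis
    using assms(1) mem_S unfolding stable_def by blast
qed

text \<open>This is why the way ties are broken does not affect the learned set.\<close>

lemma stable_unique: "stable \<theta> L \<Longrightarrow> stable \<theta> L' \<Longrightarrow> L = L'"
  by (intro antisym stable_mono) auto

text \<open>\<open>I\<close> indexes the chunks whose points are active, while \<open>T\<close> is
  the whole dataset. The size of \<open>T\<close> divides both the frequency and the threshold and
  cancels, so the effective threshold on \<open>h\<close> depends only on \<open>card I\<close>. The
  loop invariant is that \<open>N\<close> consists of the unfit points of these chunks and that
  \<open>L\<close> is greedy in each class.\<close>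

lemma train_loop_stable:
  assumes "train_loop S V \<tau> \<gamma> T L M N L' M'"
    and I: "finite I" "I \<noteq> {}" "I \<subseteq> {1..}" and T: "card T > 0"
    and "N = unfit V \<tau> L (chunks I)" "L \<subseteq> S"
    and "\<And>c. c \<in> {1..C} \<Longrightarrow> greedy (F c) h (\<gamma> / (real (card I) * real n)) (L \<inter> F c)"
  shows "stable (\<gamma> / (real (card I) * real n)) L' \<and> M' = M \<union> unfit V \<tau> L' (chunks I)"
proof -
  let ?\<theta> = "\<gamma> / (real (card I) * real n)"
  let ?q = "real (card I) * real n / real (card T)"
  have pos: "real (card I) * real n > 0" using I n_pos by (simp add: card_gt_0_iff)
  then have q: "?q > 0" using T by simp
  have freq: "freq V v T (unfit V \<tau> L (chunks I)) = ?q * h v L" for v L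
    unfolding freq_def sum_unfit_chunks[OF I(1,3)] by simp
  have threshold: "\<gamma> / real (card T) = ?q * ?\<theta>"
    using pos T by (simp add: zero_less_mult_iff)
  show ?thesis using assms(1,6-)
  proof (induction rule: train_loop.induct)
    case (finished L M)
    \<comment> \<open>This exit is impossible: a point without features is still active.\<close>
    obtain l where l: "l \<in> I" "l \<ge> 1" using I by auto
    obtain x y where "(x, y) \<in> Tc l" "V x = {}" using exists_empty_point l(2) by blast
    then have "(x, y) \<in> unfit V \<tau> L (chunks I)" using l \<tau> by (auto simp: unfit_def)
    then show ?case using finished by auto
  next
    case (learn N L v M L' M')
    have v: "v \<in> S - L"
      using learn.hyps(2) by (simp add: is_arg_max_def)
    have max: "h u L \<le> h v L" if "u \<in> S - L" for u
    proof -
      have "?q * h u L \<le> ?q * h v L"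
        using learn.hyps(2) that unfolding is_arg_max_def learn.prems(1) freq not_less[symmetric] by blast
      then show ?thesis using q by (simp only: mult_le_cancel_left_pos)
    qed
    have le: "?\<theta> \<le> h v L"
      using learn.hyps(3) q unfolding learn.prems(1) freq threshold by (simp only: mult_le_cancel_left_pos)
    have fin: "finite (V x)" if "(x, y) \<in> chunks I" for x y
      using that I(3) finite_V by (metis UN_E atLeast_iff subsetD)
    show ?case
    proof (rule learn.IH)
      show "unfit V \<tau> (L \<union> {v}) N = unfit V \<tau> (L \<union> {v}) (chunks I)"
        unfolding learn.prems(1) using fin by (intro unfit_unfit) auto
      show "L \<union> {v} \<subseteq> S" using v learn.prems(2) by auto
    next
      fix c assume c: "c \<in> {1..C}"
      show "greedy (F c) h ?\<theta> ((L \<union> {v}) \<inter> F c)"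
      proof (cases "v \<in> F c")
        case True
        have "greedy (F c) h ?\<theta> (insert v (L \<inter> F c))"
        \<comment> \<open>A maximizer over all of \<open>S - L\<close> is one within its own class,
          and \<open>h\<close> there sees only \<open>L \<inter> F c\<close>.\<close>
        proof (rule greedy.insert)
          show "h u (L \<inter> F c) \<le> h v (L \<inter> F c)" if "u \<in> F c - L \<inter> F c" for u
            using that max[of u] F_subset_S[OF c] c True by (auto simp: h_local)
        qed (use learn.prems(3) c v True le in \<open>auto simp: h_local\<close>)
        then show ?thesis using True by (simp add: Int_insert_left)
      next
        case False
        then have "(L \<union> {v}) \<inter> F c = L \<inter> F c" by auto
        then show ?thesis using learn.prems(3) c by simp
      qed
    qed
  next
    case (memorize N L M)
    have "h u L < ?\<theta>" if "u \<in> S - L" for u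
      using memorize.hyps(2)[OF that] q unfolding memorize.prems(1) freq threshold
      by (simp only: mult_less_cancel_left_pos)
    then show ?case
      using memorize.prems by (simp add: stable_def)
  qed
qed

section \<open>Runs of the experiments\<close>

lemma card_data_upto: "card (data_upto Tc j) = j * n"
proof -
  have "card (data_upto Tc j) = (\<Sum>l\<in>{1..j}. card (Tc l))"
    unfolding data_upto_def using card_chunk disjoint_chunks
    by (intro card_UN_disjoint) (auto simp: disjoint_family_on_def)
  also have "\<dots> = (\<Sum>l\<in>{1..j}. n)" using card_chunk by (intro sum.cong) auto
  finally show ?thesis by simp
qed

text \<open>The empty set fits nothing, so all \<open>j\<close> chunks are active and the threshold
  on \<open>h\<close> shrinks like \<open>1 / j\<close>.\<close>

lemma cold_run_stable:
  assumes "cold_run S V \<tau> \<gamma> Tc L M" "j \<ge> 1"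
  shows "stable (\<gamma> / (real j * real n)) (L j)"
proof -
  have "train_loop S V \<tau> \<gamma> (data_upto Tc j) {} {} (init_active V \<tau> (data_upto Tc j) {} {}) (L j) (M j)"
    using assms by (auto simp: cold_run_def trains_def)
  moreover have "init_active V \<tau> (data_upto Tc j) {} {} = unfit V \<tau> {} (chunks {1..j})"
    by (auto simp: init_active_def unfit_def data_upto_def)
  ultimately show ?thesis
    using train_loop_stable[of "data_upto Tc j" "{}" "{}" _ "L j" "M j" "{1..j}"]
      assms(2) card_data_upto[of j] n_pos by (simp add: greedy.empty)
qed

text \<open>
  All old data points are either fitted or memorized, so only the newest chunk is active.
\<close>

lemma init_active_warm:
  assumes "j \<ge> 1"
  shows "init_active V \<tau> (data_upto Tc j) L (unfit V \<tau> L (data_upto Tc (j - 1))) = unfit V \<tau> L (Tc j)"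
proof -
  have "data_upto Tc j = data_upto Tc (j - 1) \<union> Tc j"
    using assms by (cases j) (auto simp: data_upto_def atLeastAtMostSuc_conv)
  moreover have "data_upto Tc (j - 1) \<inter> Tc j = {}"
  proof -
    have "Tc l \<inter> Tc j = {}" if "l \<in> {1..j - 1}" for l
      using that assms by (intro disjoint_family_onD[OF disjoint_chunks]) auto
    then show ?thesis unfolding data_upto_def by blast
  qed
  ultimately show ?thesis by (auto simp: init_active_def unfit_def)
qed

text \<open>Only chunk \<open>j\<close> is active, so the loop lemma applies with
  \<open>I = {j}\<close> and the threshold stays \<open>\<gamma> / n\<close>.\<close>

lemma warm_run_step:
  assumes "trains S V \<tau> \<gamma> (data_upto Tc j) L (unfit V \<tau> L (data_upto Tc (j - 1))) L' M'"
    and "j \<ge> 1" "L \<subseteq> S" "\<And>c. c \<in> {1..C} \<Longrightarrow> greedy (F c) h (\<gamma> / real n) (L \<inter> F c)"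
  shows "stable (\<gamma> / real n) L' \<and>
    M' = unfit V \<tau> L (data_upto Tc (j - 1)) \<union> unfit V \<tau> L' (Tc j)"
proof -
  have "train_loop S V \<tau> \<gamma> (data_upto Tc j) L (unfit V \<tau> L (data_upto Tc (j - 1)))
      (unfit V \<tau> L (Tc j)) L' M'"
    using assms(1) unfolding trains_def init_active_warm[OF assms(2)] .
  from train_loop_stable[OF this, of "{j}"] show ?thesis
    using assms(2-4) card_data_upto[of j] n_pos by simp
qed

lemma warm_run_trains:
  "warm_run S V \<tau> \<gamma> Tc L M \<Longrightarrow> j \<ge> 1 \<Longrightarrow> trains S V \<tau> \<gamma> (data_upto Tc j) (L (j - 1)) (M (j - 1)) (L j) (M j)"
  by (simp add: warm_run_def)

text \<open>Each restart from \<open>G\<close> ends in a stable set for the same threshold, which is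
  \<open>G\<close> again by uniqueness. The form of \<open>M j\<close> is carried along because the
  next step needs it.\<close>

lemma warm_run_stable:
  assumes "warm_run S V \<tau> \<gamma> Tc L M" "stable (\<gamma> / real n) G" "j \<ge> 1"
  shows "L j = G \<and> M j = unfit V \<tau> G (data_upto Tc j)"
  using assms(3)
proof (induction j rule: dec_induct)
  case base
  \<comment> \<open>Brings the empty initial memory into the form expected by the step
    lemma.\<close>
  have "unfit V \<tau> {} (data_upto Tc 0) = {}"
    by (simp add: data_upto_def unfit_def)
  then have "trains S V \<tau> \<gamma> (data_upto Tc 1) {} (unfit V \<tau> {} (data_upto Tc (1 - 1))) (L 1) (M 1)"
    using warm_run_trains[OF assms(1), of 1] assms(1) by (simp add: warm_run_def)
  from warm_run_step[OF this] have "stable (\<gamma> / real n) (L 1)" "M 1 = unfit V \<tau> (L 1) (Tc 1)"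
    by (auto simp: data_upto_def unfit_def intro: greedy.empty)
  then show ?case
    using stable_unique[OF _ assms(2)] by (auto simp: data_upto_def)
next
  case (step j)
  have "trains S V \<tau> \<gamma> (data_upto Tc (Suc j)) G (unfit V \<tau> G (data_upto Tc (Suc j - 1))) (L (Suc j)) (M (Suc j))"
    using warm_run_trains[OF assms(1), of "Suc j"] step.IH by simp
  from warm_run_step[OF this] assms(2)
  have s: "stable (\<gamma> / real n) (L (Suc j))"
    and M: "M (Suc j) = unfit V \<tau> G (data_upto Tc j) \<union> unfit V \<tau> (L (Suc j)) (Tc (Suc j))"
    by (auto simp: stable_def)
  have "L (Suc j) = G" using s assms(2) by (rule stable_unique)
  with M show ?case
    by (auto simp: unfit_def data_upto_def atLeastAtMostSuc_conv)
qed

text \<open>A warm experiment starts with at most one chunk of active points, a cold one with all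
  \<open>j\<close> chunks; experiment 2 makes the inequality strict.\<close>

lemma time_warm_less_time_cold:
  assumes "warm_run S V \<tau> \<gamma> Tc L M" "stable (\<gamma> / real n) G" "J \<ge> 2"
  shows "time_warm V \<tau> Tc L M J < time_cold V \<tau> Tc J"
proof -
  have "card (init_active V \<tau> (data_upto Tc j) (L (j - 1)) (M (j - 1))) \<le> n" if j: "j \<ge> 1" for j
  proof -
    have "M (j - 1) = unfit V \<tau> (L (j - 1)) (data_upto Tc (j - 1))"
      using warm_run_stable[OF assms(1,2), of "j - 1"] assms(1) j
      by (cases "j = 1") (auto simp: warm_run_def data_upto_def unfit_def)
    then have "init_active V \<tau> (data_upto Tc j) (L (j - 1)) (M (j - 1)) \<subseteq> Tc j"
      using init_active_warm[OF j] by (auto simp: unfit_def)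
    then show ?thesis using card_mono card_chunk[OF j] by metis
  qed
  then have "time_warm V \<tau> Tc L M J \<le> (\<Sum>j\<in>{1..J}. n)"
    unfolding time_warm_def by (intro sum_mono) auto
  also have "\<dots> < (\<Sum>j\<in>{1..J}. j * n)"
    using assms(3) n_pos by (intro sum_strict_mono_ex1) (auto intro!: bexI[of _ 2])
  also have "\<dots> = time_cold V \<tau> Tc J"
    unfolding time_cold_def
  proof (intro sum.cong refl)
    fix j
    have "init_active V \<tau> (data_upto Tc j) {} {} = data_upto Tc j"
      using \<tau> by (auto simp: init_active_def)
    then show "j * n = card (init_active V \<tau> (data_upto Tc j) {} {})"
      using card_data_upto by simp
  qed
  finally show ?thesis .
qed

section \<open>Accuracy\<close>

lemma acc_factor_pos: "(real C - 1) / real C * (1 / real n) > 0"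
  using C n_pos by simp

lemma unfit_weight_antimono:
  assumes "L \<subseteq> L'" "c \<in> {1..C}" "A \<in> Pow (F c)"
  shows "real (nA A) * of_bool (card (A \<inter> L') < \<tau>) \<le> real (nA A) * of_bool (card (A \<inter> L) < \<tau>)"
  using card_Int_mono[of c A L L'] assms by auto

lemma accuracy_mono: "L \<subseteq> L' \<Longrightarrow> accuracy L \<le> accuracy L'"
  unfolding acc_def using acc_factor_pos
  by (intro diff_left_mono mult_left_mono sum_mono unfit_weight_antimono) auto

text \<open>The feature set \<open>B\<close> becomes fitted, and its weight \<open>nA B\<close> is
  positive.\<close>

lemma accuracy_strict_mono:
  assumes "L \<subseteq> L'" "c \<in> {1..C}" "B \<subseteq> F c" "card (B \<inter> L) < \<tau>" "\<tau> \<le> card (B \<inter> L')"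
  shows "accuracy L < accuracy L'"
proof -
  let ?f = "\<lambda>L c. \<Sum>A\<in>Pow (F c). real (nA A) * of_bool (card (A \<inter> L) < \<tau>)"
  note le = unfit_weight_antimono[OF assms(1)]
  have "?f L' c < ?f L c"
    using le[OF assms(2)] finite_F[OF assms(2)] assms(3-5) nA_pos[OF assms(2,3)]
    by (intro sum_strict_mono_ex1) (auto intro!: bexI[of _ B])
  moreover have "?f L' d \<le> ?f L d" if "d \<in> {1..C}" for d
    using le[OF that] by (intro sum_mono) auto
  ultimately have "(\<Sum>d\<in>{1..C}. ?f L' d) < (\<Sum>d\<in>{1..C}. ?f L d)"
    using assms(2) by (intro sum_strict_mono_ex1) auto
  then show ?thesis
    unfolding acc_def using acc_factor_pos by (intro diff_strict_left_mono mult_strict_left_mono)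
qed

text \<open>Below \<open>\<tau> - 1\<close> learned features, \<open>h\<close> still has its initial
  values in the class. One of the \<open>\<tau> - 1\<close> frequent features would then be
  unlearned although it reaches the threshold.\<close>

lemma stable_card_class:
  assumes "stable (\<gamma> / real n) G" "c \<in> {1..C}"
  shows "\<tau> - 1 \<le> card (G \<inter> F c)"
proof (rule ccontr)
  assume less: "\<not> \<tau> - 1 \<le> card (G \<inter> F c)"
  obtain v where v: "inj_on v {1..\<tau>}" "v ` {1..\<tau>} \<subseteq> F c"
    "\<And>i. i \<in> {1..\<tau> - 1} \<Longrightarrow> \<gamma> / real n \<le> h (v i) {}"
    using learnable[OF assms(2)] freq_chunk[of 1] by auto
  have "card (v ` {1..\<tau> - 1}) = \<tau> - 1"
    using card_image[OF inj_on_subset[OF v(1), of "{1..\<tau> - 1}"]] by auto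
  then have "\<not> v ` {1..\<tau> - 1} \<subseteq> G \<inter> F c"
    using less card_mono[of "G \<inter> F c" "v ` {1..\<tau> - 1}"] finite_F[OF assms(2)] by auto
  then obtain i where i: "i \<in> {1..\<tau> - 1}" "v i \<notin> G \<inter> F c" by blast
  have mem: "v i \<in> F c" using i(1) v(2) by (force simp: image_subset_iff)
  have "h (v i) G = h (v i) {}" using mem assms(2) less by (intro h_eq_empty) auto
  moreover have "h (v i) G < \<gamma> / real n"
    using assms(2) i(2) mem F_subset_S by (intro stable_less[OF assms(1)]) auto
  ultimately show False using v(3)[OF i(1)] by simp
qed

text \<open>The value at the time of learning is at most the initial value.\<close>

lemma greedy_value_empty:
  "greedy B h \<theta> L \<Longrightarrow> v \<in> L \<Longrightarrow> \<theta> \<le> h v {}"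
  by (induction rule: greedy.induct) (auto intro: order_trans[OF _ h_le_empty])

text \<open>The feature \<open>v \<tau>\<close> starts below the threshold, so it is never
  learned.\<close>

lemma stable_psubset:
  assumes "stable (\<gamma> / real n) G"
  shows "G \<subset> S"
proof -
  have c: "1 \<in> {1..C}" using C by simp
  obtain v where v: "v ` {1..\<tau>} \<subseteq> F 1" "h (v \<tau>) {} < \<gamma> / real n"
    using learnable[OF c] freq_chunk[of 1] by auto
  then have mem: "v \<tau> \<in> F 1" using \<tau> by auto
  have "v \<tau> \<notin> G"
  proof
    assume "v \<tau> \<in> G"
    then show False
      using greedy_value_empty[of "F 1" "\<gamma> / real n" "G \<inter> F 1" "v \<tau>"] mem v(2) assms c
      by (auto simp: stable_def)
  qed
  then show ?thesis
    using assms mem F_subset_S[OF c] by (auto simp: stable_def)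
qed

text \<open>A new feature \<open>v\<close> together with \<open>\<tau> - 1\<close> features of
  \<open>G\<close> from its class is a feature set fitted by \<open>L\<close> but not by
  \<open>G\<close>.\<close>

lemma stable_accuracy_strict_mono:
  assumes G: "stable (\<gamma> / real n) G" and L: "G \<subset> L" "L \<subseteq> S"
  shows "accuracy G < accuracy L"
proof -
  obtain v c where v: "v \<in> L - G" "c \<in> {1..C}" "v \<in> F c"
    using L mem_S by blast
  have fin: "finite (F c)" using v(2) by (rule finite_F)
  obtain D where D: "D \<subseteq> G \<inter> F c" "card D = \<tau> - 1"
    using obtain_subset_with_card_n[OF stable_card_class[OF G v(2)]] by blast
  have "finite D" using D(1) fin finite_subset by blast
  moreover have "v \<notin> D" using D(1) v(1) by blast
  ultimately have card: "card (insert v D) = \<tau>" using D(2) \<tau> by simp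
  have "insert v D \<inter> G = D" "insert v D \<inter> L = insert v D" using D(1) v L by auto
  then show ?thesis
    using D card v L(1) \<tau> by (intro accuracy_strict_mono[where B = "insert v D" and c = c]) auto
qed

end

section \<open>Comparison of warm and cold runs through the common set \<open>G\<close>\<close>

theorem theorem3p4:
  fixes C K \<tau> n :: nat and \<gamma> :: real
    and F :: "nat \<Rightarrow> 'f set"
    and V :: "'x \<Rightarrow> 'f set"
    and Tc :: "nat \<Rightarrow> ('x \<times> nat) set"
    and nA :: "'f set \<Rightarrow> nat"
    and S :: "'f set"
  defines "S \<equiv> all_features C F"
  assumes C: "C \<ge> 2"
    and card_F: "\<And>c. c \<in> {1..C} \<Longrightarrow> finite (F c) \<and> card (F c) = K"
    and disjoint_F: "disjoint_family_on F {1..C}"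
    and \<tau>: "1 \<le> \<tau>" "\<tau> < K"
    and \<gamma>: "\<gamma> > 0"
    and disjoint_chunks: "disjoint_family_on Tc {1..}"
    and card_chunk: "\<And>j. j \<ge> 1 \<Longrightarrow> finite (Tc j) \<and> card (Tc j) = n"
    and data_points: "\<And>j x y. j \<ge> 1 \<Longrightarrow> (x, y) \<in> Tc j \<Longrightarrow> y \<in> {1..C} \<and> V x \<subseteq> F y"
    and nA_pos: "\<And>c A. c \<in> {1..C} \<Longrightarrow> A \<subseteq> F c \<Longrightarrow> nA A \<ge> 1"
    and nA_count: "\<And>j c A. j \<ge> 1 \<Longrightarrow> c \<in> {1..C} \<Longrightarrow> A \<subseteq> F c \<Longrightarrow>
          card {(x, y) \<in> Tc j. y = c \<and> V x = A} = nA A"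
    and h_inj: "\<And>L c v1 v2. L \<subseteq> S \<Longrightarrow> c \<in> {1..C} \<Longrightarrow> v1 \<in> F c \<Longrightarrow> v2 \<in> F c \<Longrightarrow>
          hfun C F \<tau> n nA v1 L = hfun C F \<tau> n nA v2 L \<Longrightarrow> v1 = v2"
    and learnable: "\<And>c. c \<in> {1..C} \<Longrightarrow>
          \<exists>v :: nat \<Rightarrow> 'f. inj_on v {1..\<tau>} \<and> v ` {1..\<tau>} \<subseteq> F c \<and>
            (\<forall>j\<ge>1. (\<forall>i\<in>{1..\<tau> - 1}. freq V (v i) (Tc j) (Tc j) \<ge> \<gamma> / real n) \<and>
                   freq V (v \<tau>) (Tc j) (Tc j) < \<gamma> / real n)"
  shows "\<exists>G. G \<noteq> {} \<and> G \<subset> S \<and>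
     (\<forall>L M. warm_run S V \<tau> \<gamma> Tc L M \<longrightarrow> L 1 = G) \<and>
     (\<forall>L M. cold_run S V \<tau> \<gamma> Tc L M \<longrightarrow> L 1 = G) \<and>
     (\<forall>Lw Mw Lc Mc. warm_run S V \<tau> \<gamma> Tc Lw Mw \<longrightarrow> cold_run S V \<tau> \<gamma> Tc Lc Mc \<longrightarrow>
        (\<forall>J\<ge>2. acc C F \<tau> n nA (Lw J) \<le> acc C F \<tau> n nA (Lc J) \<and>
               time_warm V \<tau> Tc Lw Mw J < time_cold V \<tau> Tc J)) \<and>
     (let \<delta> = Max ((\<lambda>v. hfun C F \<tau> n nA v G) ` (S - G)) in
        \<delta> > 0 \<and>
        (\<forall>Lw Mw Lc Mc. warm_run S V \<tau> \<gamma> Tc Lw Mw \<longrightarrow> cold_run S V \<tau> \<gamma> Tc Lc Mc \<longrightarrow>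
           (\<forall>J\<ge>1. real J > \<gamma> / (\<delta> * real n) \<longrightarrow>
              acc C F \<tau> n nA (Lw J) < acc C F \<tau> n nA (Lc J))))"
proof -
  interpret expanding_dataset C K \<tau> n \<gamma> F V Tc nA
    using assms unfolding S_def by unfold_locales
  obtain L0 M0 where "cold_run S V \<tau> \<gamma> Tc L0 M0"
    using cold_run_exists[OF finite_S] unfolding S_def by blast
  \<comment> \<open>The first experiment of any cold run serves as witness, its threshold being
    \<open>\<gamma> / (1 * n)\<close>.\<close>
  then obtain G where G: "stable (\<gamma> / real n) G"
    using cold_run_stable[of L0 M0 1] unfolding S_def by auto
  have warm: "Lw j = G" if "warm_run S V \<tau> \<gamma> Tc Lw Mw" "j \<ge> 1" for Lw Mw j
    using warm_run_stable[OF _ G] that unfolding S_def by blast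
  have cold: "stable (\<gamma> / (real j * real n)) (Lc j)" if "cold_run S V \<tau> \<gamma> Tc Lc Mc" "j \<ge> 1" for Lc Mc j
    using cold_run_stable that unfolding S_def by blast
  have G_cold: "G \<subseteq> Lc j" if "cold_run S V \<tau> \<gamma> Tc Lc Mc" "j \<ge> 1" for Lc Mc j
    using stable_mono[OF G cold[OF that]] that(2) \<gamma> n_pos by (simp add: frac_le)
  have psub: "G \<subset> S" using stable_psubset[OF G] unfolding S_def .
  \<comment> \<open>Nonemptiness of \<open>G\<close> rests on
    \<open>\<tau> - 1 \<ge> 1\<close>.\<close>
  have "1 \<le> card (G \<inter> F 1)"
    using stable_card_class[OF G, of 1] \<tau>_ge_2 C by simp
  then have "G \<noteq> {}" by auto
  let ?\<delta> = "Max ((\<lambda>v. hfun C F \<tau> n nA v G) ` (S - G))"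
  have "?\<delta> \<in> (\<lambda>v. hfun C F \<tau> n nA v G) ` (S - G)"
    using psub finite_S by (intro Max_in) (auto simp: S_def)
  then obtain v where v: "v \<in> S - G" "?\<delta> = hfun C F \<tau> n nA v G" by blast
  have \<delta>: "?\<delta> > 0" using v h_pos[of v G] unfolding S_def by simp
  have strict: "acc C F \<tau> n nA (Lw J) < acc C F \<tau> n nA (Lc J)"
    if runs: "warm_run S V \<tau> \<gamma> Tc Lw Mw" "cold_run S V \<tau> \<gamma> Tc Lc Mc"
      and J: "J \<ge> 1" "real J > \<gamma> / (?\<delta> * real n)" for Lw Mw Lc Mc J
  proof -
    have "\<gamma> / (real J * real n) < ?\<delta>"
      using J \<delta> n_pos by (simp add: field_simps)
    \<comment> \<open>If \<open>G\<close> were the cold outcome, the maximizer \<open>v\<close>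
      would be unlearned with value \<open>\<delta>\<close> above the threshold.\<close>
    then have "Lc J \<noteq> G"
      using stable_less[OF cold[OF runs(2) J(1)], of v] v unfolding S_def by auto
    then have "G \<subset> Lc J" using G_cold[OF runs(2) J(1)] by blast
    then show ?thesis
      using stable_accuracy_strict_mono[OF G] cold[OF runs(2) J(1)] warm[OF runs(1) J(1)]
      by (simp add: stable_def)
  qed
  show ?thesis
    unfolding Let_def
  proof (intro exI[of _ G] conjI allI impI)
    fix L M assume "cold_run S V \<tau> \<gamma> Tc L M"
    then show "L 1 = G" using cold[of L M 1] by (intro stable_unique[OF _ G]) simp
  next
    fix Lw Mw Lc Mc J
    assume "warm_run S V \<tau> \<gamma> Tc Lw Mw" "cold_run S V \<tau> \<gamma> Tc Lc Mc" "2 \<le> (J :: nat)"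
    then show "acc C F \<tau> n nA (Lw J) \<le> acc C F \<tau> n nA (Lc J)"
      using warm G_cold accuracy_mono by simp
  next
    fix Lw Mw and Lc :: "nat \<Rightarrow> 'f set" and Mc :: "nat \<Rightarrow> ('x \<times> nat) set" and J
    assume "warm_run S V \<tau> \<gamma> Tc Lw Mw" "2 \<le> (J :: nat)"
    then show "time_warm V \<tau> Tc Lw Mw J < time_cold V \<tau> Tc J"
      using time_warm_less_time_cold[OF _ G] unfolding S_def by blast
  next
    fix Lw Mw Lc Mc J
    assume "warm_run S V \<tau> \<gamma> Tc Lw Mw" "cold_run S V \<tau> \<gamma> Tc Lc Mc" "1 \<le> (J :: nat)"
      "\<gamma> / (?\<delta> * real n) < real J"
    then show "acc C F \<tau> n nA (Lw J) < acc C F \<tau> n nA (Lc J)" by (rule strict)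
  qed (use \<open>G \<noteq> {}\<close> psub warm \<delta> in simp_all)
qed

end
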